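(* Let $H\sim N(0,1)$ and $\varepsilon\sim N(0,\sigma^2)$ be independent. Under passive observation the target is $$Y^0=H+\varepsilon.$$ For $c\in[0,1]$, define the forecaster $f_c(H)=cH$ and suppose deployment induces action $A=\alpha f_c(H)$ with adoption intensity $\alpha\ge 0$. Let the deployed target be $$Y^{c,\alpha}=H-\gamma\alpha cH+\varepsilon,$$ where $\gamma>0$. Let $R_0(f_c)=\mathbb{E}[(f_c(H)-Y^0)^2]$ be the passive risk and $R_\alpha(f_c)=\mathbb{E}[(f_c(H)-Y^{c,\alpha})^2]$ the deployment risk. Then for every $c\in[0,1]$, $$R_0(f_c)=(c-1)^2+\sigma^2,\qquad R_\alpha(f_c)=\big(c(1+\gamma\alpha)-1\big)^2+\sigma^2.$$ Moreover, fix any $c'\in[0,1)$. Then $f_1$ has strictly lower passive risk than $f_{c'}$, $$R_0(f_1)=\sigma^2<(c'-1)^2+\sigma^2=R_0(f_{c'}),$$ but $f_1$ has strictly higher deployment risk than $f_{c'}$, i.e. $R_\alpha(f_1)>R_\alpha(f_{c'})$, whenever $$\gamma\alpha>\frac{1-c'}{1+c'}.$$ The case $c'=0$ gives the threshold $\gamma\alpha>1$, and the case $c'=0.25$ gives the threshold $\gamma\alpha>0.6$.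
   Context: Risks are expected squared losses. The deployment risk of each forecaster $f_c$ is evaluated against the target $Y^{c,\alpha}$ induced by that forecaster's own deployment (so different forecasters are evaluated on different targets). The coefficient $\gamma$ is a crowding or negative-impact coefficient. *)

theory Defs
  imports "HOL-Probability.Probability"
begin

text \<open>
  The library function \<^term>\<open>normal_density\<close> takes the standard deviation, and describes a
  probability law only if that is positive. The law N(m, 0) is the point mass at m.
\<close>

definition normally_distributed :: "'a measure \<Rightarrow> ('a \<Rightarrow> real) \<Rightarrow> real \<Rightarrow> real \<Rightarrow> bool" where
  "normally_distributed M X m s \<longleftrightarrow>
     (if s = 0 then X \<in> borel_measurable M \<and> (AE \<omega> in M. X \<omega> = m)
      else distributed M lborel X (\<lambda>x. ennreal (normal_density m s x)))"

definition forecaster :: "real \<Rightarrow> real \<Rightarrow> real" where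
  "forecaster c h = c * h"

definition passive_target :: "('a \<Rightarrow> real) \<Rightarrow> ('a \<Rightarrow> real) \<Rightarrow> 'a \<Rightarrow> real" where
  "passive_target H \<epsilon> \<omega> = H \<omega> + \<epsilon> \<omega>"

definition induced_action :: "real \<Rightarrow> real \<Rightarrow> ('a \<Rightarrow> real) \<Rightarrow> 'a \<Rightarrow> real" where
  "induced_action \<alpha> c H \<omega> = \<alpha> * forecaster c (H \<omega>)"

definition deployed_target ::
    "real \<Rightarrow> real \<Rightarrow> real \<Rightarrow> ('a \<Rightarrow> real) \<Rightarrow> ('a \<Rightarrow> real) \<Rightarrow> 'a \<Rightarrow> real" where
  "deployed_target \<gamma> \<alpha> c H \<epsilon> \<omega> = H \<omega> - \<gamma> * induced_action \<alpha> c H \<omega> + \<epsilon> \<omega>"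

lemma deployed_target_explicit:
  "deployed_target \<gamma> \<alpha> c H \<epsilon> \<omega> = H \<omega> - \<gamma> * \<alpha> * c * H \<omega> + \<epsilon> \<omega>"
  by (simp add: deployed_target_def induced_action_def forecaster_def mult.assoc)

definition sq_risk :: "'a measure \<Rightarrow> ('a \<Rightarrow> real) \<Rightarrow> (real \<Rightarrow> real) \<Rightarrow> ('a \<Rightarrow> real) \<Rightarrow> real" where
  "sq_risk M H f Y = (\<integral>\<omega>. (f (H \<omega>) - Y \<omega>)\<^sup>2 \<partial>M)"

definition passive_risk ::
    "'a measure \<Rightarrow> ('a \<Rightarrow> real) \<Rightarrow> ('a \<Rightarrow> real) \<Rightarrow> real \<Rightarrow> real" where
  "passive_risk M H \<epsilon> c = sq_risk M H (forecaster c) (passive_target H \<epsilon>)"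

definition deployment_risk ::
    "'a measure \<Rightarrow> ('a \<Rightarrow> real) \<Rightarrow> ('a \<Rightarrow> real) \<Rightarrow> real \<Rightarrow> real \<Rightarrow> real \<Rightarrow> real" where
  "deployment_risk M H \<epsilon> \<gamma> \<alpha> c =
     sq_risk M H (forecaster c) (deployed_target \<gamma> \<alpha> c H \<epsilon>)"

end

theory Submission
  imports Defs
begin

text \<open>
  Both prediction errors have the form a H - \<epsilon>, with a = c - 1 under passive observation and
  a = c (1 + \<gamma> \<alpha>) - 1 under deployment. Since H and \<epsilon> are independent and centred, the
  cross term vanishes and the risk is a^2 + \<sigma>^2. With k = \<gamma> \<alpha> the comparison of deployment
  risks becomes |c' (1 + k) - 1| < k, whose only nontrivial half is 1 - c' < k (1 + c').
\<close>

text \<open>Provides the first two moments uniformly in \<open>s\<close>, so that noise with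
  \<sigma> = 0 needs no separate treatment later. The point mass is handled by almost-everywhere
  equality with a constant, the case \<open>s > 0\<close> by the Gaussian density.\<close>

lemma (in prob_space) normally_distributed_moments:
  assumes "0 \<le> s" and X: "normally_distributed M X m s"
  shows normally_distributed_integrable: "integrable M X"
    and normally_distributed_expectation: "expectation X = m"
    and normally_distributed_integrable_sq: "integrable M (\<lambda>\<omega>. (X \<omega> - m)\<^sup>2)"
    and normally_distributed_variance: "expectation (\<lambda>\<omega>. (X \<omega> - m)\<^sup>2) = s\<^sup>2"
proof -
  \<comment> \<open>\<open>has_bochner_integral\<close> joins integrability and value, so in the
    degenerate case one almost-everywhere congruence transfers both.\<close>
  have "has_bochner_integral M X m \<and> has_bochner_integral M (\<lambda>\<omega>. (X \<omega> - m)\<^sup>2) (s\<^sup>2)"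
  proof (cases "s = 0")
    case True
    then have [measurable]: "X \<in> borel_measurable M" and ae: "AE \<omega> in M. X \<omega> = m"
      using X by (auto simp: normally_distributed_def)
    have "has_bochner_integral M X m \<longleftrightarrow> has_bochner_integral M (\<lambda>_. m) m"
      using ae by (intro has_bochner_integral_cong_AE) auto
    moreover have "has_bochner_integral M (\<lambda>\<omega>. (X \<omega> - m)\<^sup>2) 0 \<longleftrightarrow>
        has_bochner_integral M (\<lambda>_. 0::real) 0"
      using ae by (intro has_bochner_integral_cong_AE) auto
    ultimately show ?thesis
      using True by (simp add: has_bochner_integral_iff prob_space)
  next
    case False
    then have s: "0 < s" and D: "distributed M lborel X (\<lambda>x. ennreal (normal_density m s x))"
      using X \<open>0 \<le> s\<close> by (auto simp: normally_distributed_def)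
    have "integrable M X"
      using distributed_integrable_var[OF D] integrable_normal_moment_nz_1[OF s] by simp
    moreover have "expectation X = m"
      by (rule Distributions.prob_space.normal_distributed_expectation[OF prob_space_axioms s D])
    moreover have "integrable M (\<lambda>\<omega>. (X \<omega> - m)\<^sup>2)"
      using distributed_integrable[OF D, of "\<lambda>x. (x - m)\<^sup>2"] integrable_normal_moment[OF s, of m 2]
      by simp
    moreover have "variance X = s\<^sup>2"
      by (rule normal_distributed_variance[OF s D])
    ultimately show ?thesis
      by (simp add: has_bochner_integral_iff)
  qed
  then show "integrable M X" "expectation X = m" "integrable M (\<lambda>\<omega>. (X \<omega> - m)\<^sup>2)"
    "expectation (\<lambda>\<omega>. (X \<omega> - m)\<^sup>2) = s\<^sup>2"
    by (auto simp: has_bochner_integral_iff)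
qed

text \<open>Expand the square: independence makes \<open>X * Y\<close> integrable and factors its
  expectation, which is then 0 because \<open>Y\<close> is centred.\<close>

lemma (in prob_space) expectation_sq_diff_indep_centred:
  fixes X Y :: "'a \<Rightarrow> real"
  assumes indep: "indep_var borel X borel Y"
    and X: "integrable M X" "integrable M (\<lambda>\<omega>. (X \<omega>)\<^sup>2)"
    and Y: "integrable M Y" "integrable M (\<lambda>\<omega>. (Y \<omega>)\<^sup>2)" "expectation Y = 0"
  shows "expectation (\<lambda>\<omega>. (a * X \<omega> - Y \<omega>)\<^sup>2) =
    a\<^sup>2 * expectation (\<lambda>\<omega>. (X \<omega>)\<^sup>2) + expectation (\<lambda>\<omega>. (Y \<omega>)\<^sup>2)"
proof -
  have XY: "integrable M (\<lambda>\<omega>. X \<omega> * Y \<omega>)"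
    by (rule indep_var_integrable[OF indep X(1) Y(1)])
  have "expectation (\<lambda>\<omega>. X \<omega> * Y \<omega>) = 0"
    using indep_var_lebesgue_integral[OF indep X(1) Y(1)] Y(3) by simp
  moreover have "(\<lambda>\<omega>. (a * X \<omega> - Y \<omega>)\<^sup>2) =
      (\<lambda>\<omega>. a\<^sup>2 * (X \<omega>)\<^sup>2 - 2 * a * (X \<omega> * Y \<omega>) + (Y \<omega>)\<^sup>2)"
    by (auto simp: power2_eq_square algebra_simps)
  ultimately show ?thesis
    using X Y XY by simp
qed

text \<open>For \<open>k\<close> = \<gamma> \<alpha>, the two sides are the deployment risks of
  \<open>c\<close> and of 1 after the common noise term \<sigma>^2 is removed.\<close>

lemma deployment_gain_less:
  fixes c k :: real
  assumes "0 \<le> c" "c < 1" "(1 - c) / (1 + c) < k"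
  shows "(c * (1 + k) - 1)\<^sup>2 < k\<^sup>2"
proof -
  have lower: "1 - c < k * (1 + c)"
    using assms by (simp add: divide_simps)
  \<comment> \<open>The threshold is nonnegative, so \<open>k\<close> is positive. This gives
    \<open>1 + k > 0\<close> for the strict multiplication below and lets the absolute value of
    \<open>k\<close> be dropped.\<close>
  have "0 \<le> (1 - c) / (1 + c)"
    using assms by simp
  then have k: "0 < k"
    using assms by linarith
  then have "c * (1 + k) < 1 * (1 + k)"
    using assms by (intro mult_strict_right_mono) auto
  \<comment> \<open>The upper half is \<open>c * (1 + k) < 1 + k\<close>; the lower half rearranges
    to \<open>lower\<close>.\<close>
  with lower have "\<bar>c * (1 + k) - 1\<bar> < \<bar>k\<bar>"
    using k by (simp add: abs_less_iff algebra_simps)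
  then show ?thesis
    by (rule power2_strict_mono)
qed

theorem theorem2:
  fixes M :: "'a measure" and H \<epsilon> :: "'a \<Rightarrow> real" and \<sigma> \<gamma> \<alpha> :: real
  assumes "prob_space M"
    and "\<sigma> \<ge> 0"
    and "normally_distributed M H 0 1"
    and "normally_distributed M \<epsilon> 0 \<sigma>"
    and "prob_space.indep_var M borel H borel \<epsilon>"
    and "\<gamma> > 0" and "\<alpha> \<ge> 0"
  shows
    "(\<forall>c\<in>{0..1}.
        passive_risk M H \<epsilon> c = (c - 1)\<^sup>2 + \<sigma>\<^sup>2 \<and>
        deployment_risk M H \<epsilon> \<gamma> \<alpha> c = (c * (1 + \<gamma> * \<alpha>) - 1)\<^sup>2 + \<sigma>\<^sup>2) \<and>
     (\<forall>c'\<in>{0..<1}.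
        passive_risk M H \<epsilon> 1 = \<sigma>\<^sup>2 \<and>
        \<sigma>\<^sup>2 < (c' - 1)\<^sup>2 + \<sigma>\<^sup>2 \<and>
        (c' - 1)\<^sup>2 + \<sigma>\<^sup>2 = passive_risk M H \<epsilon> c' \<and>
        (\<gamma> * \<alpha> > (1 - c') / (1 + c') \<longrightarrow>
           deployment_risk M H \<epsilon> \<gamma> \<alpha> 1 > deployment_risk M H \<epsilon> \<gamma> \<alpha> c')) \<and>
     ((1 - 0) / (1 + 0) = (1::real) \<and>
        (\<gamma> * \<alpha> > 1 \<longrightarrow>
           deployment_risk M H \<epsilon> \<gamma> \<alpha> 1 > deployment_risk M H \<epsilon> \<gamma> \<alpha> 0)) \<and>
     ((1 - 0.25) / (1 + 0.25) = (0.6::real) \<and>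
        (\<gamma> * \<alpha> > 0.6 \<longrightarrow>
           deployment_risk M H \<epsilon> \<gamma> \<alpha> 1 > deployment_risk M H \<epsilon> \<gamma> \<alpha> 0.25))"
proof -
  interpret prob_space M by fact
  note mH = normally_distributed_moments[OF zero_le_one assms(3)]
  note m\<epsilon> = normally_distributed_moments[OF assms(2,4)]
  have error: "expectation (\<lambda>\<omega>. (a * H \<omega> - \<epsilon> \<omega>)\<^sup>2) = a\<^sup>2 + \<sigma>\<^sup>2" for a
    using expectation_sq_diff_indep_centred[OF assms(5), of a] mH m\<epsilon> by simp
  have passive_eq: "passive_risk M H \<epsilon> c = (c - 1)\<^sup>2 + \<sigma>\<^sup>2" for c
    \<comment> \<open>Read backwards, \<open>error\<close> turns the closed form into an
      expectation, so only the integrands remain to be compared: c H - (H + \<epsilon>) = (c - 1) H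
      - \<epsilon>.\<close>
    unfolding error[symmetric]
    by (simp add: passive_risk_def sq_risk_def forecaster_def passive_target_def algebra_simps)
  have deployed_eq: "deployment_risk M H \<epsilon> \<gamma> \<alpha> c = (c * (1 + \<gamma> * \<alpha>) - 1)\<^sup>2 + \<sigma>\<^sup>2" for c
    \<comment> \<open>Here the feedback adds \<gamma> \<alpha> c to the coefficient of H, giving c
      (1 + \<gamma> \<alpha>) - 1.\<close>
    unfolding error[symmetric]
    by (simp add: deployment_risk_def sq_risk_def forecaster_def deployed_target_explicit
        algebra_simps)
  have reversal: "deployment_risk M H \<epsilon> \<gamma> \<alpha> c < deployment_risk M H \<epsilon> \<gamma> \<alpha> 1"
    if "0 \<le> c" "c < 1" "(1 - c) / (1 + c) < \<gamma> * \<alpha>" for c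
    using deployment_gain_less[OF that] by (simp add: deployed_eq)
  show ?thesis
    \<comment> \<open>The two instances evaluate the threshold to 1 and to 0.75 / 1.25 =
      0.6.\<close>
    using reversal reversal[of 0] reversal[of "0.25"] by (auto simp: passive_eq deployed_eq)
qed

end
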